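(* Let $(M,I,J)$ be a psc manifold and suppose that there exists an involution $\mathcal T$ of $M$ which is $I$-holomorphic and $J$-antiholomorphic. Then $(M,I,J)$ is a spsc manifold.
   Context: A psc (pseudoconformal) manifold $(M,I,J)$ is a real 4-dimensional manifold $M$ with complex structures $I$ and $J$ such that there is a complex 1-dimensional subbundle $\mathcal H^{(1,0)}(M,I)\subset T^{(1,0)}(M,I)$ with $({\rm id})_*\mathcal H^{(1,0)}(M,I)\subset T^{(1,0)}(M,J)$, where ${\rm id}:(M,I)\to(M,J)$, and this subbundle is maximal with this property (in terms of both dimension and uniqueness): any subbundle of $T^{(1,0)}(M,I)$ mapped by ${\rm id}_*$ into $T^{(1,0)}(M,J)$ equals $\mathcal H^{(1,0)}(M,I)$. A psc manifold $(M,I,J)$ is spsc (strictly pseudoconformal) if in addition there is a complex 1-dimensional subbundle $\mathcal V^{(1,0)}(M,I)\subset T^{(1,0)}(M,I)$ such that $T^{(1,0)}(M,I)=\mathcal H^{(1,0)}(M,I)\oplus\mathcal V^{(1,0)}(M,I)$ and ${\rm id}_*\mathcal V^{(1,0)}(M,I)$ is a complex 1-dimensional subbundle of $T^{(0,1)}(M,J)$. *)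

theory Defs
  imports "HOL-Analysis.Analysis"
begin

section \<open>Smooth maps between Euclidean spaces\<close>

text \<open>Used for open \<open>S\<close> only. In finite dimension, continuity of all directional derivatives
  \<open>x \<mapsto> Df(x) v\<close> is continuity of \<open>x \<mapsto> Df(x)\<close>.\<close>

primrec Ck_on ::
  "nat \<Rightarrow> 'b::euclidean_space set \<Rightarrow> ('b \<Rightarrow> 'c::euclidean_space) \<Rightarrow> bool" where
  "Ck_on 0 S f \<longleftrightarrow> continuous_on S f"
| "Ck_on (Suc k) S f \<longleftrightarrow> (\<forall>x\<in>S. f differentiable (at x)) \<and>
     (\<forall>v. Ck_on k S (\<lambda>x. frechet_derivative f (at x) v))"

definition smooth_on ::
  "'b::euclidean_space set \<Rightarrow> ('b \<Rightarrow> 'c::euclidean_space) \<Rightarrow> bool" where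
  "smooth_on S f \<longleftrightarrow> (\<forall>k. Ck_on k S f)"


section \<open>Charts and atlases\<close>

text \<open>The manifold is the whole type \<open>'a\<close>. Charts may take values in any Euclidean
  space: \<open>real^4\<close> for the atlas, \<open>complex^2\<close> for holomorphic coordinates.\<close>

type_synonym ('a, 'e) chart = "'a set \<times> ('a \<Rightarrow> 'e)"

abbreviation chart_dom :: "('a, 'e) chart \<Rightarrow> 'a set" where
  "chart_dom c \<equiv> fst c"

abbreviation chart_map :: "('a, 'e) chart \<Rightarrow> 'a \<Rightarrow> 'e" where
  "chart_map c \<equiv> snd c"

definition chart_inv :: "('a, 'e) chart \<Rightarrow> 'e \<Rightarrow> 'a" where
  "chart_inv c = inv_into (chart_dom c) (chart_map c)"

definition is_chart :: "('a::topological_space, 'e::euclidean_space) chart \<Rightarrow> bool" where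
  "is_chart c \<longleftrightarrow> open (chart_dom c) \<and> open (chart_map c ` chart_dom c) \<and>
     homeomorphism (chart_dom c) (chart_map c ` chart_dom c) (chart_map c) (chart_inv c)"

definition smooth_transition ::
  "('a, 'e::euclidean_space) chart \<Rightarrow> ('a, 'f::euclidean_space) chart \<Rightarrow> bool" where
  "smooth_transition c d \<longleftrightarrow>
     smooth_on (chart_map c ` (chart_dom c \<inter> chart_dom d)) (chart_map d \<circ> chart_inv c)"

definition smooth_atlas ::
  "('a::{t2_space, second_countable_topology}, 'e::euclidean_space) chart set \<Rightarrow> bool" where
  "smooth_atlas A \<longleftrightarrow> (\<forall>c\<in>A. is_chart c) \<and> (\<Union>c\<in>A. chart_dom c) = UNIV \<and>
     (\<forall>c\<in>A. \<forall>d\<in>A. smooth_transition c d)"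

definition smooth_self_map ::
  "('a::topological_space, 'e::euclidean_space) chart set \<Rightarrow> ('a \<Rightarrow> 'a) \<Rightarrow> bool" where
  "smooth_self_map A T \<longleftrightarrow> continuous_on UNIV T \<and>
     (\<forall>c\<in>A. \<forall>d\<in>A. smooth_on (chart_map c ` (chart_dom c \<inter> T -` chart_dom d))
        (chart_map d \<circ> T \<circ> chart_inv c))"


section \<open>Tangent vectors and differentials\<close>

text \<open>For every point \<open>p\<close> one chart \<open>chart_at A p\<close> of the atlas around \<open>p\<close> is selected once
  and for all, and the tangent space at \<open>p\<close> is identified with \<open>real^4\<close>, its complexification
  with \<open>complex^4\<close>, through the differential of that chart at \<open>p\<close>. The selection does not depend
  continuously on \<open>p\<close>: a vector field \<open>X :: 'a \<Rightarrow> complex^4\<close> has to be transported to a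
  fixed chart (by \<open>tangent_map A (chart_map c) p\<close>) before its smoothness can be tested.\<close>

definition chart_at :: "('a, 'e) chart set \<Rightarrow> 'a \<Rightarrow> ('a, 'e) chart" where
  "chart_at A p = (SOME c. c \<in> A \<and> p \<in> chart_dom c)"

definition tangent_map ::
  "('a, 'e::euclidean_space) chart set \<Rightarrow> ('a \<Rightarrow> 'f::euclidean_space) \<Rightarrow> 'a \<Rightarrow> 'e \<Rightarrow> 'f" where
  "tangent_map A f p =
     frechet_derivative (f \<circ> chart_inv (chart_at A p)) (at (chart_map (chart_at A p) p))"

definition self_tangent_map ::
  "('a, 'e::euclidean_space) chart set \<Rightarrow> ('a \<Rightarrow> 'a) \<Rightarrow> 'a \<Rightarrow> 'e \<Rightarrow> 'e" where
  "self_tangent_map A T p = tangent_map A (chart_map (chart_at A (T p)) \<circ> T) p"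

text \<open>The complex-linear extension \<open>v + \<i> w \<mapsto> L v + \<i> L w\<close> of a real-linear map \<open>L\<close>.\<close>

definition complexify :: "(real^'n \<Rightarrow> real^'m) \<Rightarrow> complex^'n \<Rightarrow> complex^'m" where
  "complexify L v =
     (\<chi> i. Complex (L (\<chi> j. Re (v $ j)) $ i) (L (\<chi> j. Im (v $ j)) $ i))"

definition smooth_complex_field ::
  "('a, real^4) chart set \<Rightarrow> 'a set \<Rightarrow> ('a \<Rightarrow> complex^4) \<Rightarrow> bool" where
  "smooth_complex_field A U X \<longleftrightarrow>
     (\<forall>c\<in>A. smooth_on (chart_map c ` (chart_dom c \<inter> U))
        ((\<lambda>p. complexify (tangent_map A (chart_map c) p) (X p)) \<circ> chart_inv c))"

text \<open>Smooth complex subbundles of rank \<open>k\<close> of the complexified tangent bundle; because of the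
  dimension condition, the local fields \<open>X 0, \<dots>, X (k - 1)\<close> form a frame.\<close>

definition complex_subbundle ::
  "('a::topological_space, real^4) chart set \<Rightarrow> nat \<Rightarrow> ('a \<Rightarrow> (complex^4) set) \<Rightarrow> bool" where
  "complex_subbundle A k E \<longleftrightarrow>
     (\<forall>p. vec.subspace (E p) \<and> vec.dim (E p) = k) \<and>
     (\<forall>p. \<exists>U X. open U \<and> p \<in> U \<and> (\<forall>i<k. smooth_complex_field A U (X i)) \<and>
        (\<forall>q\<in>U. E q = vec.span ((\<lambda>i. X i q) ` {..<k})))"


section \<open>Complex structures\<close>

text \<open>A complex structure is an integrable almost complex structure, where integrability is the
  existence of local holomorphic coordinates. These coordinates are diffeomorphisms taking
  \<open>I\<close> to multiplication by \<open>\<i>\<close>, so the tensor field \<open>I\<close> is automatically smooth.\<close>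

definition holomorphic_chart ::
  "('a::topological_space, real^4) chart set \<Rightarrow> ('a \<Rightarrow> real^4 \<Rightarrow> real^4)
     \<Rightarrow> ('a, complex^2) chart \<Rightarrow> bool" where
  "holomorphic_chart A I z \<longleftrightarrow> is_chart z \<and>
     (\<forall>c\<in>A. smooth_transition c z \<and> smooth_transition z c) \<and>
     (\<forall>p\<in>chart_dom z. \<forall>v.
        tangent_map A (chart_map z) p (I p v) = \<i> *s tangent_map A (chart_map z) p v)"

definition complex_structure ::
  "('a::topological_space, real^4) chart set \<Rightarrow> ('a \<Rightarrow> real^4 \<Rightarrow> real^4) \<Rightarrow> bool" where
  "complex_structure A I \<longleftrightarrow>
     (\<forall>p. linear (I p) \<and> (\<forall>v. I p (I p v) = - v)) \<and>
     (\<forall>p. \<exists>z. holomorphic_chart A I z \<and> p \<in> chart_dom z)"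

definition T10 :: "('a \<Rightarrow> real^4 \<Rightarrow> real^4) \<Rightarrow> 'a \<Rightarrow> (complex^4) set" where
  "T10 I p = {v. complexify (I p) v = \<i> *s v}"

definition T01 :: "('a \<Rightarrow> real^4 \<Rightarrow> real^4) \<Rightarrow> 'a \<Rightarrow> (complex^4) set" where
  "T01 I p = {v. complexify (I p) v = (- \<i>) *s v}"

definition holomorphic_self_map ::
  "('a::topological_space, real^4) chart set \<Rightarrow> ('a \<Rightarrow> real^4 \<Rightarrow> real^4)
     \<Rightarrow> ('a \<Rightarrow> 'a) \<Rightarrow> bool" where
  "holomorphic_self_map A I T \<longleftrightarrow> smooth_self_map A T \<and>
     (\<forall>p v. self_tangent_map A T p (I p v) = I (T p) (self_tangent_map A T p v))"

definition antiholomorphic_self_map ::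
  "('a::topological_space, real^4) chart set \<Rightarrow> ('a \<Rightarrow> real^4 \<Rightarrow> real^4)
     \<Rightarrow> ('a \<Rightarrow> 'a) \<Rightarrow> bool" where
  "antiholomorphic_self_map A J T \<longleftrightarrow> smooth_self_map A T \<and>
     (\<forall>p v. self_tangent_map A T p (J p v) = - J (T p) (self_tangent_map A T p v))"


section \<open>Pseudoconformal manifolds\<close>

definition id_push ::
  "('a, real^4) chart set \<Rightarrow> ('a \<Rightarrow> (complex^4) set) \<Rightarrow> 'a \<Rightarrow> (complex^4) set" where
  "id_push A E p = complexify (self_tangent_map A id p) ` E p"

definition common_subbundle ::
  "('a::topological_space, real^4) chart set \<Rightarrow> ('a \<Rightarrow> real^4 \<Rightarrow> real^4)
     \<Rightarrow> ('a \<Rightarrow> real^4 \<Rightarrow> real^4) \<Rightarrow> nat \<Rightarrow> ('a \<Rightarrow> (complex^4) set) \<Rightarrow> bool" where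
  "common_subbundle A I J k E \<longleftrightarrow> complex_subbundle A k E \<and>
     (\<forall>p. E p \<subseteq> T10 I p) \<and> (\<forall>p. id_push A E p \<subseteq> T10 J p)"

text \<open>The competitors \<open>E\<close> have arbitrary positive rank; the zero subbundle has to be
  excluded, since it always satisfies the condition.\<close>

definition psc_subbundle ::
  "('a::topological_space, real^4) chart set \<Rightarrow> ('a \<Rightarrow> real^4 \<Rightarrow> real^4)
     \<Rightarrow> ('a \<Rightarrow> real^4 \<Rightarrow> real^4) \<Rightarrow> ('a \<Rightarrow> (complex^4) set) \<Rightarrow> bool" where
  "psc_subbundle A I J H \<longleftrightarrow> common_subbundle A I J 1 H \<and>
     (\<forall>k\<ge>1. \<forall>E. common_subbundle A I J k E \<longrightarrow> E = H)"

definition psc_manifold ::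
  "('a::{t2_space, second_countable_topology}, real^4) chart set
     \<Rightarrow> ('a \<Rightarrow> real^4 \<Rightarrow> real^4) \<Rightarrow> ('a \<Rightarrow> real^4 \<Rightarrow> real^4) \<Rightarrow> bool" where
  "psc_manifold A I J \<longleftrightarrow> smooth_atlas A \<and> complex_structure A I \<and> complex_structure A J \<and>
     (\<exists>H. psc_subbundle A I J H)"

definition spsc_manifold ::
  "('a::{t2_space, second_countable_topology}, real^4) chart set
     \<Rightarrow> ('a \<Rightarrow> real^4 \<Rightarrow> real^4) \<Rightarrow> ('a \<Rightarrow> real^4 \<Rightarrow> real^4) \<Rightarrow> bool" where
  "spsc_manifold A I J \<longleftrightarrow> psc_manifold A I J \<and>
     (\<exists>H V. psc_subbundle A I J H \<and>
        complex_subbundle A 1 V \<and> (\<forall>p. V p \<subseteq> T10 I p) \<and>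
        (\<forall>p. T10 I p = {h + v | h v. h \<in> H p \<and> v \<in> V p} \<and> H p \<inter> V p = {0}) \<and>
        complex_subbundle A 1 (id_push A V) \<and> (\<forall>p. id_push A V p \<subseteq> T01 J p))"

end

theory Submission
  imports Defs
begin

text \<open>Let \<open>H\<close> be the complex line bundle shared by \<open>T10 I\<close> and \<open>T10 J\<close>. The second line bundle is its
  image \<open>V = dT(H)\<close> under the differential of the involution \<open>T\<close>. Since \<open>dT\<close> commutes with \<open>I\<close> and
  anticommutes with \<open>J\<close>, the bundle \<open>V\<close> lies in \<open>T10 I\<close> and in \<open>T01 J\<close>
  (\<open>push_T10\<close>, \<open>push_T01\<close>). Hence \<open>H\<close> and \<open>V\<close> meet only in zero, because \<open>H\<close> lies in \<open>T10 J\<close> and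
  \<open>T10 J \<inter> T01 J = 0\<close>. Two independent lines fill \<open>T10 I\<close>: together with their
  complex conjugates they span the four-dimensional complexified tangent space
  (\<open>T10_eq_sum_of_lines\<close>).

  What costs work is that \<open>V\<close> is a smooth subbundle of rank 1 (\<open>complex_subbundle_push\<close>). The rank
  is preserved because the differentials of an involution at \<open>p\<close> and at \<open>T p\<close> are
  inverse to each other. For smoothness, a frame \<open>X\<close> of \<open>H\<close> near \<open>T q\<close> is carried to a frame of
  \<open>V\<close> near \<open>q\<close>. Tangent vectors are recorded in a chart that is selected pointwise,
  without any continuity, so the transported frame has to be rewritten in two fixed charts
  \<open>c\<close> around \<open>q\<close> and \<open>d\<close> around \<open>T q\<close>: there it is \<open>x \<mapsto> DF(G x) (Z (G x))\<close>, where \<open>G\<close> and \<open>F\<close>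
  are \<open>T\<close> read from \<open>c\<close> to \<open>d\<close> and from \<open>d\<close> to \<open>c\<close>, and \<open>Z\<close> is \<open>X\<close> read in \<open>d\<close>. The chain rule
  \<open>chart_chain_rule\<close> removes the selected charts, and the closure properties of smooth functions
  do the rest.\<close>

section \<open>Calculus of smooth maps\<close>

text \<open>The derivatives in \<open>Ck_on\<close> are two-sided, so the values of a function outside \<open>S\<close> could matter;
  on an open set they do not.\<close>

lemma Ck_on_cong:
  assumes "open S" "\<And>x. x \<in> S \<Longrightarrow> f x = g x" "Ck_on k S f"
  shows "Ck_on k S g"
  using assms(2,3)
proof (induction k arbitrary: f g)
  case 0
  then show ?case using continuous_on_cong by (metis Ck_on.simps(1))
next
  case (Suc k)
  have der: "(g has_derivative frechet_derivative f (at x)) (at x)" if "x \<in> S" for x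
    using Suc.prems that assms(1) has_derivative_transform_within_open[of f _ x UNIV S g]
    by (auto simp: frechet_derivative_works)
  have eq: "frechet_derivative g (at x) = frechet_derivative f (at x)" if "x \<in> S" for x
    using frechet_derivative_at[OF der[OF that]] by simp
  have "Ck_on k S (\<lambda>x. frechet_derivative g (at x) v)" for v
    by (rule Suc.IH[where f = "\<lambda>x. frechet_derivative f (at x) v"]) (use Suc.prems eq in auto)
  then show ?case using der by (auto simp: differentiable_def)
qed

lemma Ck_on_local:
  assumes "\<And>x. x \<in> S \<Longrightarrow> \<exists>N. open N \<and> x \<in> N \<and> Ck_on k N f"
  shows "Ck_on k S f"
  using assms
proof (induction k arbitrary: f)
  case 0
  then have "isCont f x" if "x \<in> S" for x
    using that by (metis Ck_on.simps(1) continuous_on_eq_continuous_at)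
  then show ?case by (simp add: continuous_at_imp_continuous_on)
next
  case (Suc k)
  have "f differentiable (at x)" if "x \<in> S" for x
    using Suc.prems[OF that] by auto
  moreover have "Ck_on k S (\<lambda>x. frechet_derivative f (at x) v)" for v
    by (rule Suc.IH) (use Suc.prems in fastforce)
  ultimately show ?case by simp
qed

lemma Ck_on_subset: "Ck_on k S f \<Longrightarrow> T \<subseteq> S \<Longrightarrow> Ck_on k T f"
  by (induction k arbitrary: f) (auto intro: continuous_on_subset)

lemma Ck_on_SucD: "Ck_on (Suc k) S f \<Longrightarrow> Ck_on k S f"
proof (induction k arbitrary: f)
  case 0
  then show ?case
    by (auto intro!: continuous_at_imp_continuous_on differentiable_imp_continuous_within)
next
  case (Suc k)
  then show ?case
    by (metis Ck_on.simps(2))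
qed

text \<open>\<open>Ck_on\<close> refers to the chosen derivative \<open>frechet_derivative\<close>. This rule admits any explicit formula
  for the derivative instead, which is how all closure properties below are proved by
  induction on the order.\<close>

lemma Ck_on_SucI:
  assumes "open S" "\<And>x. x \<in> S \<Longrightarrow> (f has_derivative D x) (at x)" "\<And>v. Ck_on k S (\<lambda>x. D x v)"
  shows "Ck_on (Suc k) S f"
proof -
  have eq: "frechet_derivative f (at x) = D x" if "x \<in> S" for x
    using frechet_derivative_at[OF assms(2)[OF that]] by simp
  have "Ck_on k S (\<lambda>x. frechet_derivative f (at x) v)" for v
    by (rule Ck_on_cong[OF assms(1) _ assms(3)[of v]]) (simp add: eq)
  then show ?thesis
    using assms(2) by (auto simp: differentiable_def)
qed

lemma Ck_on_has_derivative:
  "Ck_on (Suc k) S f \<Longrightarrow> x \<in> S \<Longrightarrow> (f has_derivative frechet_derivative f (at x)) (at x)"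
  by (simp add: frechet_derivative_works)

lemma Ck_on_const: "open S \<Longrightarrow> Ck_on k S (\<lambda>x. c)"
proof (induction k arbitrary: c)
  case (Suc k)
  then show ?case
    by (intro Ck_on_SucI[where D = "\<lambda>x v. 0"]) auto
qed simp

lemma Ck_on_bounded_linear:
  assumes "open S" "bounded_linear L" "Ck_on k S f"
  shows "Ck_on k S (\<lambda>x. L (f x))"
  using assms(3)
proof (induction k arbitrary: f)
  case 0
  then show ?case
    using assms(2) by (simp add: bounded_linear.continuous_on)
next
  case (Suc k)
  show ?case
    by (rule Ck_on_SucI[OF assms(1) bounded_linear.has_derivative[OF assms(2)
          Ck_on_has_derivative[OF Suc.prems]]])
       (use Suc in auto)
qed

lemma Ck_on_add:
  assumes "open S" "Ck_on k S f" "Ck_on k S g"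
  shows "Ck_on k S (\<lambda>x. f x + g x)"
  using assms(2,3)
proof (induction k arbitrary: f g)
  case 0
  then show ?case by (simp add: continuous_on_add)
next
  case (Suc k)
  show ?case
    by (rule Ck_on_SucI[OF assms(1) has_derivative_add[OF
          Ck_on_has_derivative[OF Suc.prems(1)] Ck_on_has_derivative[OF Suc.prems(2)]]])
       (use Suc in auto)
qed

lemma Ck_on_sum:
  assumes "open S" "\<And>i. i \<in> F \<Longrightarrow> Ck_on k S (f i)"
  shows "Ck_on k S (\<lambda>x. \<Sum>i\<in>F. f i x)"
  using assms(2)
  by (induction F rule: infinite_finite_induct)
     (auto intro: Ck_on_const[OF assms(1)] Ck_on_add[OF assms(1)])

lemma Ck_on_scaleR:
  assumes "open S" "Ck_on k S f" "Ck_on k S g"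
  shows "Ck_on k S (\<lambda>x. f x *\<^sub>R g x)"
  using assms(2,3)
proof (induction k arbitrary: f g)
  case 0
  then show ?case by (simp add: continuous_on_scaleR)
next
  case (Suc k)
  show ?case
    by (rule Ck_on_SucI[OF assms(1) has_derivative_scaleR[OF
          Ck_on_has_derivative[OF Suc.prems(1)] Ck_on_has_derivative[OF Suc.prems(2)]]])
       (use Suc.prems Ck_on_SucD[OF Suc.prems(1)] Ck_on_SucD[OF Suc.prems(2)]
          in \<open>auto intro!: Ck_on_add assms(1) Suc.IH\<close>)
qed

text \<open>The chain rule writes a directional derivative of a composite as
  \<open>\<Sum>b. (Dg(x) v \<bullet> b) *\<^sub>R Df(g x) b\<close>, which is again built from composites of functions
  with one derivative less.\<close>

lemma Ck_on_compose:
  fixes g :: "'a::euclidean_space \<Rightarrow> 'b::euclidean_space" and f :: "'b \<Rightarrow> 'c::euclidean_space"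
  assumes "open S" "g ` S \<subseteq> T" "Ck_on k S g" "Ck_on k T f"
  shows "Ck_on k S (\<lambda>x. f (g x))"
  using assms(3,4)
proof (induction k arbitrary: f)
  case 0
  then show ?case
    using assms(2) by (auto intro: continuous_on_compose2)
next
  case (Suc k)
  let ?Dg = "\<lambda>x. frechet_derivative g (at x)" and ?Df = "\<lambda>y. frechet_derivative f (at y)"
  have der: "((\<lambda>x. f (g x)) has_derivative
      (\<lambda>v. \<Sum>b\<in>Basis. (?Dg x v \<bullet> b) *\<^sub>R ?Df (g x) b)) (at x)" if "x \<in> S" for x
  proof -
    have f: "(f has_derivative ?Df (g x)) (at (g x))"
      using Suc.prems(2) assms(2) that by (auto simp: frechet_derivative_works)
    have "?Df (g x) w = (\<Sum>b\<in>Basis. (w \<bullet> b) *\<^sub>R ?Df (g x) b)" for w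
      using linear_sum[OF has_derivative_linear[OF f], of "\<lambda>b. (w \<bullet> b) *\<^sub>R b" Basis]
      by (simp add: euclidean_representation linear_scale[OF has_derivative_linear[OF f]])
    then have "(f has_derivative (\<lambda>w. \<Sum>b\<in>Basis. (w \<bullet> b) *\<^sub>R ?Df (g x) b)) (at (g x))"
      by (intro has_derivative_eq_rhs[OF f] ext)
    then show ?thesis
      by (rule has_derivative_compose[OF Ck_on_has_derivative[OF Suc.prems(1) that]])
  qed
  have "Ck_on k S (\<lambda>x. (?Dg x v \<bullet> b) *\<^sub>R ?Df (g x) b)" for v b
  proof (rule Ck_on_scaleR[OF assms(1)])
    show "Ck_on k S (\<lambda>x. ?Dg x v \<bullet> b)"
      using Suc.prems(1) by (intro Ck_on_bounded_linear[OF assms(1) bounded_linear_inner_left]) simp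
    show "Ck_on k S (\<lambda>x. ?Df (g x) b)"
      using Suc.prems Ck_on_SucD by (intro Suc.IH) auto
  qed
  then show ?case
    by (intro Ck_on_SucI[OF assms(1) der] Ck_on_sum[OF assms(1)])
qed

lemma smooth_on_differentiable: "smooth_on S f \<Longrightarrow> x \<in> S \<Longrightarrow> f differentiable (at x)"
  unfolding smooth_on_def by (metis Ck_on.simps(2))

lemma smooth_on_subset: "smooth_on S f \<Longrightarrow> T \<subseteq> S \<Longrightarrow> smooth_on T f"
  unfolding smooth_on_def using Ck_on_subset by blast

lemma smooth_on_cong: "open S \<Longrightarrow> (\<And>x. x \<in> S \<Longrightarrow> f x = g x) \<Longrightarrow> smooth_on S f \<Longrightarrow> smooth_on S g"
  unfolding smooth_on_def using Ck_on_cong by blast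

lemma smooth_on_local:
  "(\<And>x. x \<in> S \<Longrightarrow> \<exists>N. open N \<and> x \<in> N \<and> smooth_on N f) \<Longrightarrow> smooth_on S f"
  unfolding smooth_on_def by (metis Ck_on_local)

lemma smooth_on_compose:
  "open S \<Longrightarrow> g ` S \<subseteq> T \<Longrightarrow> smooth_on S g \<Longrightarrow> smooth_on T f \<Longrightarrow> smooth_on S (\<lambda>x. f (g x))"
  unfolding smooth_on_def using Ck_on_compose by blast

lemma smooth_on_frechet_derivative:
  "smooth_on S f \<Longrightarrow> smooth_on S (\<lambda>x. frechet_derivative f (at x) v)"
  unfolding smooth_on_def by (metis Ck_on.simps(2))


section \<open>Complexified linear maps\<close>

text \<open>The complexification of \<open>L\<close> has the same real matrix as \<open>L\<close>.\<close>

lemma complexify_component: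
  fixes L :: "real^'n \<Rightarrow> real^'m"
  assumes "linear L"
  shows "complexify L w $ i = (\<Sum>j\<in>UNIV. (L (axis j 1) $ i) *\<^sub>R w $ j)"
proof -
  have 1: "L x $ i = (\<Sum>j\<in>UNIV. x $ j * L (axis j 1) $ i)" for x
  proof -
    have "L x $ i = L (\<Sum>j\<in>UNIV. x $ j *\<^sub>R axis j 1) $ i"
      using basis_expansion[of x] by (simp add: scalar_mult_eq_scaleR)
    also have "\<dots> = (\<Sum>j\<in>UNIV. x $ j * L (axis j 1) $ i)"
      by (simp add: linear_sum[OF assms] linear_scale[OF assms])
    finally show ?thesis .
  qed
  show ?thesis
    unfolding complexify_def
    by (simp add: complex_eq_iff 1[of "\<chi> j. Re (w $ j)"] 1[of "\<chi> j. Im (w $ j)"] mult.commute)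
qed

lemma complexify_linear:
  assumes "linear L"
  shows "Vector_Spaces.linear (*s) (*s) (complexify L)"
proof -
  have "complexify L = (*v) (\<chi> i j. complex_of_real (L (axis j 1) $ i))"
    by (auto simp: fun_eq_iff vec_eq_iff complexify_component[OF assms] matrix_vector_mult_def
        scaleR_conv_of_real)
  then show ?thesis by simp
qed

lemma complexify_compose: "complexify L (complexify M w) = complexify (L \<circ> M) w"
  by (simp add: complexify_def)

lemma complexify_id [simp]: "complexify id w = w"
  by (simp add: complexify_def vec_eq_iff)

lemma complexify_minus: "complexify (\<lambda>v. - L v) w = - complexify L w"
  by (simp add: complexify_def vec_eq_iff complex_eq_iff)

definition conj_vec :: "complex^'n \<Rightarrow> complex^'n" where
  "conj_vec w = (\<chi> i. cnj (w $ i))"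

lemma complexify_conj_vec:
  assumes "linear L"
  shows "complexify L (conj_vec w) = conj_vec (complexify L w)"
  by (simp add: vec_eq_iff complexify_component[OF assms] conj_vec_def)

text \<open>In components, the result is a sum of products of smooth matrix entries and smooth coordinates.\<close>

lemma smooth_on_complexify:
  fixes L :: "'b::euclidean_space \<Rightarrow> real^'n \<Rightarrow> real^'m" and w :: "'b \<Rightarrow> complex^'n"
  assumes "open S" "\<And>x. x \<in> S \<Longrightarrow> linear (L x)" "\<And>v. smooth_on S (\<lambda>x. L x v)" "smooth_on S w"
  shows "smooth_on S (\<lambda>x. complexify (L x) (w x))"
proof (rule smooth_on_cong[OF assms(1)])
  let ?e = "\<lambda>i j (u::complex^'n). axis i (u $ j) :: complex^'m"
  show "(\<Sum>i\<in>UNIV. \<Sum>j\<in>UNIV. (L x (axis j 1) $ i) *\<^sub>R ?e i j (w x)) = complexify (L x) (w x)"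
    if "x \<in> S" for x
  proof (rule iffD2[OF vec_eq_iff], intro allI)
    fix k
    have "(\<Sum>i\<in>UNIV. \<Sum>j\<in>UNIV. (L x (axis j 1) $ i) *\<^sub>R ?e i j (w x)) $ k
       = (\<Sum>i\<in>UNIV. if i = k then \<Sum>j\<in>UNIV. (L x (axis j 1) $ k) *\<^sub>R w x $ j else 0)"
      unfolding sum_component vector_scaleR_component by (intro sum.cong refl) (simp add: axis_def)
    then show "(\<Sum>i\<in>UNIV. \<Sum>j\<in>UNIV. (L x (axis j 1) $ i) *\<^sub>R ?e i j (w x)) $ k
       = complexify (L x) (w x) $ k"
      by (simp add: complexify_component[OF assms(2)[OF that]])
  qed
  have e: "bounded_linear (?e i j)" for i j
    by (intro linear_conv_bounded_linear[THEN iffD1] linearI) (auto simp: vec_eq_iff axis_def)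
  show "smooth_on S (\<lambda>x. \<Sum>i\<in>UNIV. \<Sum>j\<in>UNIV. (L x (axis j 1) $ i) *\<^sub>R ?e i j (w x))"
    using assms(3,4) unfolding smooth_on_def
    by (intro allI Ck_on_sum Ck_on_scaleR assms(1) Ck_on_bounded_linear[OF _ bounded_linear_vec_nth]
        Ck_on_bounded_linear[OF _ e]) auto
qed


section \<open>Tangent maps in charts\<close>

lemma chart_inv_left: "is_chart c \<Longrightarrow> p \<in> chart_dom c \<Longrightarrow> chart_inv c (chart_map c p) = p"
  unfolding is_chart_def by (auto intro: homeomorphism_apply1)

lemma open_chart_image:
  assumes "is_chart c" "open U"
  shows "open (chart_map c ` (chart_dom c \<inter> U))"
proof -
  have "openin (top_of_set (chart_map c ` chart_dom c)) (chart_map c ` (chart_dom c \<inter> U))"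
    using assms unfolding is_chart_def by (blast intro: homeomorphism_imp_open_map openin_open_Int)
  then show ?thesis
    using assms(1) openin_open_eq unfolding is_chart_def by blast
qed

lemma chart_at:
  assumes "smooth_atlas A"
  shows "chart_at A p \<in> A" "p \<in> chart_dom (chart_at A p)"
proof -
  have "\<exists>c. c \<in> A \<and> p \<in> chart_dom c"
    using assms unfolding smooth_atlas_def by blast
  from someI_ex[OF this] show "chart_at A p \<in> A" "p \<in> chart_dom (chart_at A p)"
    unfolding chart_at_def by auto
qed

lemma atlas_is_chart: "smooth_atlas A \<Longrightarrow> c \<in> A \<Longrightarrow> is_chart c"
  unfolding smooth_atlas_def by blast

lemma smooth_self_map_id: "smooth_atlas A \<Longrightarrow> smooth_self_map A id"
  unfolding smooth_atlas_def smooth_self_map_def smooth_transition_def by simp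

lemma smooth_self_map_differentiable:
  assumes "smooth_self_map A S" "c \<in> A" "e \<in> A" "p \<in> chart_dom c" "S p \<in> chart_dom e"
  shows "(chart_map e \<circ> S \<circ> chart_inv c) differentiable (at (chart_map c p))"
  using assms unfolding smooth_self_map_def by (intro smooth_on_differentiable) auto

text \<open>The composite \<open>f \<circ> S\<close> read in \<open>c\<close> agrees, near the point in question, with \<open>f\<close> read in \<open>e\<close> after \<open>S\<close>
  read from \<open>c\<close> to \<open>e\<close>. Taking the selected charts for \<open>c\<close> and \<open>e\<close> gives functoriality
  of the tangent map; taking \<open>S = id\<close> gives the change from the selected chart to another one.\<close>

lemma chart_chain_rule:
  assumes A: "smooth_atlas A" and S: "smooth_self_map A S"
    and c: "c \<in> A" "p \<in> chart_dom c" and e: "e \<in> A" "S p \<in> chart_dom e"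
    and f: "(f \<circ> chart_inv e) differentiable (at (chart_map e (S p)))"
  shows "frechet_derivative (f \<circ> S \<circ> chart_inv c) (at (chart_map c p)) =
    frechet_derivative (f \<circ> chart_inv e) (at (chart_map e (S p))) \<circ>
    frechet_derivative (chart_map e \<circ> S \<circ> chart_inv c) (at (chart_map c p))"
proof -
  let ?F = "f \<circ> chart_inv e" and ?G = "chart_map e \<circ> S \<circ> chart_inv c" and ?x = "chart_map c p"
  let ?N = "chart_map c ` (chart_dom c \<inter> S -` chart_dom e)"
  have charts: "is_chart c" "is_chart e"
    using atlas_is_chart[OF A] c e by blast+
  have Gx: "?G ?x = chart_map e (S p)"
    using charts c by (simp add: chart_inv_left)
  have F: "?F differentiable (at (?G ?x))" using f Gx by simp
  have G: "?G differentiable (at ?x)"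
    by (rule smooth_self_map_differentiable[OF S c(1) e(1) c(2) e(2)])
  have N: "open ?N"
    using S charts unfolding smooth_self_map_def is_chart_def[of e]
    by (auto intro!: open_chart_image open_vimage)
  have "frechet_derivative (f \<circ> S \<circ> chart_inv c) (at ?x) = frechet_derivative (?F \<circ> ?G) (at ?x)"
  proof (rule frechet_derivative_transform_within_open[OF _ N, symmetric])
    show "(?F \<circ> ?G) differentiable (at ?x)"
      using differentiable_chain_at[OF G F] .
  qed (use c e charts in \<open>auto simp: chart_inv_left\<close>)
  also have "\<dots> = frechet_derivative ?F (at (?G ?x)) \<circ> frechet_derivative ?G (at ?x)"
    by (rule frechet_derivative_compose[OF G F])
  finally show ?thesis using Gx by simp
qed

lemma tangent_map_compose:
  assumes "smooth_atlas A" "smooth_self_map A S"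
    and "(f \<circ> chart_inv (chart_at A (S p))) differentiable (at (chart_map (chart_at A (S p)) (S p)))"
  shows "tangent_map A (f \<circ> S) p = tangent_map A f (S p) \<circ> self_tangent_map A S p"
  unfolding tangent_map_def self_tangent_map_def
  using assms chart_chain_rule[OF assms(1,2), of "chart_at A p" p "chart_at A (S p)" f]
  by (simp add: chart_at)

lemma tangent_map_in_chart:
  assumes "smooth_atlas A" "d \<in> A" "p \<in> chart_dom d"
    and "(f \<circ> chart_inv d) differentiable (at (chart_map d p))"
  shows "tangent_map A f p =
    frechet_derivative (f \<circ> chart_inv d) (at (chart_map d p)) \<circ> tangent_map A (chart_map d) p"
  unfolding tangent_map_def
  using assms chart_chain_rule[OF assms(1) smooth_self_map_id[OF assms(1)], of "chart_at A p" p d f]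
  by (simp add: chart_at)

text \<open>The selected chart is the one in which tangent vectors at \<open>p\<close> are expressed, so its own
  differential is the identity. Consequently \<open>id_push\<close> changes nothing.\<close>

lemma tangent_map_chart_at:
  assumes "smooth_atlas A"
  shows "tangent_map A (chart_map (chart_at A p)) p = id"
proof -
  let ?c = "chart_at A p"
  have c: "is_chart ?c" "p \<in> chart_dom ?c"
    using chart_at[OF assms] atlas_is_chart[OF assms] by blast+
  have "frechet_derivative id (at (chart_map ?c p)) =
      frechet_derivative (chart_map ?c \<circ> chart_inv ?c) (at (chart_map ?c p))"
  proof (rule frechet_derivative_transform_within_open)
    show "open (chart_map ?c ` chart_dom ?c)" using c unfolding is_chart_def by blast
  qed (use c in \<open>auto simp: chart_inv_left id_def\<close>)
  then show ?thesis by (simp add: tangent_map_def)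
qed

lemma linear_self_tangent_map:
  assumes "smooth_atlas A" "smooth_self_map A S"
  shows "linear (self_tangent_map A S p)"
  unfolding self_tangent_map_def tangent_map_def
  using assms by (intro linear_frechet_derivative smooth_self_map_differentiable) (auto simp: chart_at)

lemma self_tangent_map_id:
  assumes "smooth_atlas A"
  shows "self_tangent_map A id p = id"
  using tangent_map_chart_at[OF assms] by (simp add: self_tangent_map_def)

lemma id_push_eq:
  assumes "smooth_atlas A"
  shows "id_push A E = E"
  by (auto simp: id_push_def fun_eq_iff self_tangent_map_id[OF assms] image_iff)

text \<open>Differentiate \<open>S \<circ> S = id\<close>.\<close>

lemma self_tangent_map_involution:
  assumes A: "smooth_atlas A" and S: "smooth_self_map A S" and inv: "\<And>p. S (S p) = p"
  shows "self_tangent_map A S (S p) \<circ> self_tangent_map A S p = id"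
proof -
  let ?f = "chart_map (chart_at A p) \<circ> S"
  have "(?f \<circ> chart_inv (chart_at A (S p))) differentiable (at (chart_map (chart_at A (S p)) (S p)))"
    using smooth_self_map_differentiable[OF S] by (simp add: chart_at[OF A] inv)
  from tangent_map_compose[OF A S this]
  have "tangent_map A (?f \<circ> S) p = self_tangent_map A S (S p) \<circ> self_tangent_map A S p"
    by (simp add: self_tangent_map_def inv del: o_apply comp_apply)
  moreover have "?f \<circ> S = chart_map (chart_at A p)"
    by (simp add: fun_eq_iff inv)
  ultimately show ?thesis using tangent_map_chart_at[OF A] by metis
qed


section \<open>Pushing a subbundle forward by an involution\<close>

text \<open>A pushforward would take the fibre over \<open>q\<close> from the preimage of \<open>q\<close>, which is \<open>S q\<close> for an involution.\<close>

definition involution_push ::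
  "('a, real^4) chart set \<Rightarrow> ('a \<Rightarrow> 'a) \<Rightarrow> ('a \<Rightarrow> (complex^4) set) \<Rightarrow> 'a \<Rightarrow> (complex^4) set" where
  "involution_push A S E q = complexify (self_tangent_map A S (S q)) ` E (S q)"

text \<open>Smoothness is tested in an arbitrary chart \<open>c\<close> near a point \<open>q0\<close>. With a chart \<open>d\<close> fixed around
  \<open>S q0\<close>, the transported field is the derivative of \<open>S\<close> read from \<open>d\<close> to \<open>c\<close>, applied to \<open>X\<close> read
  in \<open>d\<close>; both depend smoothly on the point.\<close>

lemma smooth_complex_field_push:
  assumes A: "smooth_atlas A" and S: "smooth_self_map A S" and inv: "\<And>p. S (S p) = p"
    and U: "open U" and X: "smooth_complex_field A U X"
  shows "smooth_complex_field A (S -` U) (\<lambda>q. complexify (self_tangent_map A S (S q)) (X (S q)))"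
  unfolding smooth_complex_field_def
proof (intro ballI smooth_on_local)
  fix c x assume c: "c \<in> A" and "x \<in> chart_map c ` (chart_dom c \<inter> S -` U)"
  then obtain q0 where q0: "x = chart_map c q0" "q0 \<in> chart_dom c" "S q0 \<in> U" by auto
  define d where "d = chart_at A (S q0)"
  have d: "d \<in> A" "S q0 \<in> chart_dom d"
    unfolding d_def using chart_at[OF A] by auto
  have charts: "is_chart c" "is_chart d"
    using atlas_is_chart[OF A] c d by blast+
  let ?F = "chart_map c \<circ> S \<circ> chart_inv d" and ?G = "chart_map d \<circ> S \<circ> chart_inv c"
  let ?Z = "(\<lambda>p. complexify (tangent_map A (chart_map d) p) (X p)) \<circ> chart_inv d"
  let ?Y = "(\<lambda>p. complexify (tangent_map A (chart_map c) p)
      (complexify (self_tangent_map A S (S p)) (X (S p)))) \<circ> chart_inv c"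
  define Q where "Q = S -` chart_dom d \<inter> S -` U"
  let ?N = "chart_map c ` (chart_dom c \<inter> Q)"
  let ?W = "chart_map d ` (chart_dom d \<inter> (S -` chart_dom c \<inter> U))"
  have S_cont: "continuous_on UNIV S" using S unfolding smooth_self_map_def by blast
  have N: "open ?N" unfolding Q_def
    using charts U S_cont unfolding is_chart_def[of d]
    by (intro open_chart_image open_Int open_vimage charts) auto
  have G: "smooth_on ?N ?G"
    by (rule smooth_on_subset[of "chart_map c ` (chart_dom c \<inter> S -` chart_dom d)"])
       (use S c d in \<open>auto simp: smooth_self_map_def Q_def\<close>)
  have F: "smooth_on ?W ?F"
    by (rule smooth_on_subset[of "chart_map d ` (chart_dom d \<inter> S -` chart_dom c)"])
       (use S c d in \<open>auto simp: smooth_self_map_def\<close>)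
  have Z: "smooth_on ?W ?Z"
    by (rule smooth_on_subset[of "chart_map d ` (chart_dom d \<inter> U)"])
       (use X d in \<open>auto simp: smooth_complex_field_def\<close>)
  have GN: "?G ` ?N \<subseteq> ?W"
    using charts by (auto simp: chart_inv_left Q_def inv)
  have "smooth_on ?N (\<lambda>x. complexify (frechet_derivative ?F (at (?G x))) (?Z (?G x)))"
  proof (rule smooth_on_complexify[OF N])
    show "linear (frechet_derivative ?F (at (?G x)))" if "x \<in> ?N" for x
      using GN that by (intro linear_frechet_derivative smooth_on_differentiable[OF F]) blast
    show "smooth_on ?N (\<lambda>x. frechet_derivative ?F (at (?G x)) v)" for v
      by (rule smooth_on_compose[OF N GN G smooth_on_frechet_derivative[OF F]])
    show "smooth_on ?N (\<lambda>x. ?Z (?G x))"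
      by (rule smooth_on_compose[OF N GN G Z])
  qed
  moreover have "complexify (frechet_derivative ?F (at (?G x))) (?Z (?G x)) = ?Y x"
    if "x \<in> ?N" for x
  proof -
    obtain q where q: "x = chart_map c q" "q \<in> chart_dom c" "S q \<in> chart_dom d" "S q \<in> U"
      using \<open>x \<in> ?N\<close> unfolding Q_def by auto
    have cinv: "chart_inv c x = q" "?G x = chart_map d (S q)" "chart_inv d (?G x) = S q"
      using q charts by (auto simp: chart_inv_left)
    \<comment> \<open>The differential of \<open>chart_map c \<circ> S\<close> at \<open>S q\<close> is computed twice: through the selected chart
      at \<open>q\<close>, which yields the transported field, and through \<open>d\<close>, which yields the smooth formula.\<close>
    have 1: "tangent_map A (chart_map c \<circ> S) (S q)
        = tangent_map A (chart_map c) q \<circ> self_tangent_map A S (S q)"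
    proof -
      have "(chart_map c \<circ> chart_inv (chart_at A q)) differentiable
          (at (chart_map (chart_at A q) q))"
        using smooth_self_map_differentiable[OF smooth_self_map_id[OF A], of "chart_at A q" c q]
          chart_at[OF A] c q by simp
      then show ?thesis
        using tangent_map_compose[OF A S, of "chart_map c" "S q"] by (simp add: inv)
    qed
    have 2: "tangent_map A (chart_map c \<circ> S) (S q)
        = frechet_derivative ?F (at (chart_map d (S q))) \<circ> tangent_map A (chart_map d) (S q)"
      by (rule tangent_map_in_chart[OF A d(1) q(3)])
         (rule smooth_self_map_differentiable[OF S d(1) c q(3)], simp add: inv q)
    have "?Y x = complexify (tangent_map A (chart_map c \<circ> S) (S q)) (X (S q))"
      by (simp add: cinv complexify_compose 1)
    also have "\<dots> = complexify (frechet_derivative ?F (at (?G x))) (?Z (?G x))"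
      using cinv by (simp add: complexify_compose 2)
    finally show ?thesis by simp
  qed
  ultimately have "smooth_on ?N ?Y"
    by (rule smooth_on_cong[OF N, rotated])
  moreover have "x \<in> ?N"
    using q0 d unfolding Q_def by auto
  ultimately show "\<exists>N. open N \<and> x \<in> N \<and> smooth_on N ?Y"
    using N by blast
qed

lemma complex_subbundle_push:
  assumes A: "smooth_atlas A" and S: "smooth_self_map A S" and inv: "\<And>p. S (S p) = p"
    and E: "complex_subbundle A k E"
  shows "complex_subbundle A k (involution_push A S E)"
  unfolding complex_subbundle_def
proof (intro conjI allI)
  fix q
  let ?C = "\<lambda>q. complexify (self_tangent_map A S (S q))"
  have lin: "Vector_Spaces.linear (*s) (*s) (?C q)" for q
    by (intro complexify_linear linear_self_tangent_map A S)
  have "complexify (self_tangent_map A S q) (?C q w) = w" for w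
    using self_tangent_map_involution[OF A S inv, of "S q"] by (simp add: complexify_compose inv)
  then have "inj (?C q)" by (metis injI)
  have Eq: "vec.subspace (E (S q))" "vec.dim (E (S q)) = k"
    using E unfolding complex_subbundle_def by auto
  show "vec.subspace (involution_push A S E q)"
    unfolding involution_push_def by (rule vec.linear_subspace_image[OF lin Eq(1)])
  show "vec.dim (involution_push A S E q) = k"
    unfolding involution_push_def
    using vec.dim_image_eq[OF lin inj_on_subset[OF \<open>inj (?C q)\<close> subset_UNIV]] Eq(2) by simp
  obtain U X where U: "open U" "S q \<in> U" "\<And>i. i < k \<Longrightarrow> smooth_complex_field A U (X i)"
      "\<And>p. p \<in> U \<Longrightarrow> E p = vec.span ((\<lambda>i. X i p) ` {..<k})"
    using E unfolding complex_subbundle_def by metis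
  show "\<exists>U X. open U \<and> q \<in> U \<and> (\<forall>i<k. smooth_complex_field A U (X i)) \<and>
      (\<forall>q\<in>U. involution_push A S E q = vec.span ((\<lambda>i. X i q) ` {..<k}))"
  proof (intro exI[of _ "S -` U"] exI[of _ "\<lambda>i q. ?C q (X i (S q))"] conjI allI impI ballI)
    show "open (S -` U)"
      using S U(1) unfolding smooth_self_map_def by (blast intro: open_vimage)
    show "smooth_complex_field A (S -` U) (\<lambda>q. ?C q (X i (S q)))" if "i < k" for i
      by (rule smooth_complex_field_push[OF A S inv U(1) U(3)[OF that]])
    show "involution_push A S E q = vec.span ((\<lambda>i. ?C q (X i (S q))) ` {..<k})"
      if "q \<in> S -` U" for q
      using U(4)[of "S q"] that vec.linear_span_image[OF lin, of q "(\<lambda>i. X i (S q)) ` {..<k}"]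
      by (simp add: involution_push_def image_image)
  qed (use U in auto)
qed

text \<open>The differential of an \<open>I\<close>-holomorphic map commutes with \<open>I\<close>, hence preserves eigenspaces. The
  differential of a \<open>J\<close>-antiholomorphic map, in \<open>push_T01\<close>, turns the eigenvalue \<open>\<i>\<close> into \<open>- \<i>\<close>.\<close>

lemma push_T10:
  assumes "holomorphic_self_map A I S" and A: "smooth_atlas A" and inv: "\<And>p. S (S p) = p"
    and E: "E (S q) \<subseteq> T10 I (S q)"
  shows "involution_push A S E q \<subseteq> T10 I q"
proof
  let ?M = "self_tangent_map A S (S q)"
  have lin: "linear ?M"
    using assms(1) unfolding holomorphic_self_map_def by (intro linear_self_tangent_map[OF A]) blast
  fix w assume "w \<in> involution_push A S E q"
  then obtain u where u: "w = complexify ?M u" "complexify (I (S q)) u = \<i> *s u"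
    using E unfolding involution_push_def T10_def by auto
  have "I q \<circ> ?M = ?M \<circ> I (S q)"
    using assms(1) unfolding holomorphic_self_map_def by (auto simp: inv)
  then have "complexify (I q) w = complexify ?M (complexify (I (S q)) u)"
    by (simp only: u(1) complexify_compose)
  also have "\<dots> = \<i> *s w"
    by (simp only: u vec.linear_scale[OF complexify_linear[OF lin]])
  finally show "w \<in> T10 I q" by (simp add: T10_def)
qed

lemma push_T01:
  assumes "antiholomorphic_self_map A J S" and A: "smooth_atlas A" and inv: "\<And>p. S (S p) = p"
    and E: "E (S q) \<subseteq> T10 J (S q)"
  shows "involution_push A S E q \<subseteq> T01 J q"
proof
  let ?M = "self_tangent_map A S (S q)"
  have lin: "linear ?M"
    using assms(1) unfolding antiholomorphic_self_map_def by (intro linear_self_tangent_map[OF A]) blast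
  fix w assume "w \<in> involution_push A S E q"
  then obtain u where u: "w = complexify ?M u" "complexify (J (S q)) u = \<i> *s u"
    using E unfolding involution_push_def T10_def by auto
  have "J q \<circ> ?M = (\<lambda>v. - (?M \<circ> J (S q)) v)"
    using assms(1) unfolding antiholomorphic_self_map_def by (auto simp: inv)
  then have "complexify (J q) w = - complexify ?M (complexify (J (S q)) u)"
    by (simp only: u(1) complexify_compose complexify_minus)
  also have "\<dots> = (- \<i>) *s w"
    by (simp only: u vec.linear_scale[OF complexify_linear[OF lin]] vec.scale_minus_left)
  finally show "w \<in> T01 J q" by (simp add: T01_def)
qed


section \<open>Lines in the holomorphic tangent space\<close>

lemma conj_vec_simps:
  "conj_vec (v + w) = conj_vec v + conj_vec w" "conj_vec (a *s w) = cnj a *s conj_vec w"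
  "conj_vec (conj_vec w) = w" "conj_vec 0 = 0" "conj_vec (- w) = - conj_vec w"
  by (simp_all add: conj_vec_def vec_eq_iff)

lemma T10_Int_T01: "T10 J p \<inter> T01 J p \<subseteq> {0}"
  by (auto simp: T10_def T01_def vec_eq_iff complex_eq_iff)

lemma subspace_T10: "linear (J p) \<Longrightarrow> vec.subspace (T10 J p)"
  unfolding T10_def vec.subspace_def
  by (simp add: vec.linear_add[OF complexify_linear] vec.linear_scale[OF complexify_linear]
      vec.linear_0[OF complexify_linear] vec.scale_right_distrib vector_smult_assoc mult.commute)

lemma conj_vec_T10: "linear (J p) \<Longrightarrow> w \<in> T10 J p \<Longrightarrow> conj_vec w \<in> T01 J p"
  by (simp add: T10_def T01_def complexify_conj_vec conj_vec_simps vec.scale_minus_left)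

text \<open>Pick generators \<open>h\<close> and \<open>v\<close> of the two lines. The vectors \<open>h\<close>, \<open>v\<close> and their conjugates, which lie in
  \<open>T01 I p\<close>, are independent, hence a basis of \<open>complex^4\<close>. Expanding an element of \<open>T10 I p\<close> in this
  basis, the conjugate part lies in \<open>T10 I p \<inter> T01 I p\<close> and vanishes.\<close>

lemma T10_eq_sum_of_lines:
  assumes I: "linear (I p)"
    and H: "vec.subspace H" "vec.dim H = 1" "H \<subseteq> T10 I p"
    and V: "vec.subspace V" "vec.dim V = 1" "V \<subseteq> T10 I p"
    and HV: "H \<inter> V = {0}"
  shows "T10 I p = {h + v | h v. h \<in> H \<and> v \<in> V}"
proof (intro equalityI subsetI)
  fix u assume "u \<in> {h + v | h v. h \<in> H \<and> v \<in> V}"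
  then show "u \<in> T10 I p"
    using H(3) V(3) vec.subspace_add[OF subspace_T10[where J = I, OF I]] by blast
next
  fix u assume u: "u \<in> T10 I p"
  have nonzero: "\<exists>w\<in>E. w \<noteq> 0" if "vec.dim E = 1" for E :: "(complex^4) set"
    using that vec.dim_subset[of E "{0}"] by force
  obtain h v where hv: "h \<in> H" "h \<noteq> 0" "v \<in> V" "v \<noteq> 0"
    using nonzero[OF H(2)] nonzero[OF V(2)] by blast
  have T10: "a *s h + b *s v \<in> T10 I p" for a b
    using hv H V subspace_T10[where J = I, OF I] by (meson subsetD vec.subspace_add vec.subspace_scale)
  have indep: "a = 0 \<and> b = 0" if "a *s h + b *s v = 0" for a b
  proof -
    have "a *s h = (- b) *s v"
      using that by (simp add: vec.scale_minus_left add_eq_0_iff2)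
    moreover have "a *s h \<in> H" "(- b) *s v \<in> V"
      by (rule vec.subspace_scale[OF H(1) hv(1)], rule vec.subspace_scale[OF V(1) hv(3)])
    ultimately have "a *s h = 0" "(- b) *s v = 0" by (metis HV IntI singletonD)+
    then show ?thesis using hv by simp
  qed
  \<comment> \<open>The linear combination of \<open>h\<close>, \<open>v\<close>, \<open>conj_vec h\<close>, \<open>conj_vec v\<close> with coefficients \<open>x\<close>; the inner
    conjugations cancel the antilinearity of \<open>conj_vec\<close>.\<close>
  define f where "f x = (x $ 1 *s h + x $ 2 *s v) + conj_vec (cnj (x $ 3) *s h + cnj (x $ 4) *s v)"
    for x :: "complex^4"
  have lin: "Vector_Spaces.linear (*s) (*s) f"
    unfolding f_def
    by unfold_locales (simp_all add: conj_vec_simps vec_eq_iff algebra_simps)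
  have split0: "a = 0 \<and> b = 0" if "a + conj_vec b = 0" "a \<in> T10 I p" "b \<in> T10 I p" for a b
  proof -
    have "conj_vec b = (- 1) *s a"
      using that(1) by (simp add: eq_neg_iff_add_eq_0 add.commute)
    then have "conj_vec b \<in> T10 I p"
      using vec.subspace_scale[OF subspace_T10[where J = I, OF I] that(2)] by metis
    then have "conj_vec b = 0"
      using conj_vec_T10[where J = I, OF I that(3)] T10_Int_T01[of I p] by blast
    then show ?thesis using that(1) conj_vec_simps(3,4) by (metis add.right_neutral)
  qed
  have "x = 0" if "f x = 0" for x
  proof -
    have "x $ 1 = 0 \<and> x $ 2 = 0" "cnj (x $ 3) = 0 \<and> cnj (x $ 4) = 0"
      using split0[OF that[unfolded f_def] T10 T10] indep by auto
    then show ?thesis by (auto simp: vec_eq_iff forall_4)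
  qed
  then have "inj f"
    using vec.linear_inj_iff_eq_0[OF lin] by blast
  then have "surj f"
    using vec.linear_injective_imp_surjective[OF lin] by blast
  then obtain x where "u = f x" by blast
  then have "(x $ 1 *s h + x $ 2 *s v + (- 1) *s u)
      + conj_vec (cnj (x $ 3) *s h + cnj (x $ 4) *s v) = 0"
    by (simp add: f_def)
  moreover have "x $ 1 *s h + x $ 2 *s v + (- 1) *s u \<in> T10 I p"
    using T10 u subspace_T10[where J = I, OF I] by (meson vec.subspace_add vec.subspace_scale)
  ultimately have "x $ 1 *s h + x $ 2 *s v + (- 1) *s u = 0"
    using split0 T10 by blast
  then have "u = x $ 1 *s h + x $ 2 *s v" by simp
  moreover have "x $ 1 *s h \<in> H" "x $ 2 *s v \<in> V"
    using hv H V by (auto intro: vec.subspace_scale)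
  ultimately show "u \<in> {h + v | h v. h \<in> H \<and> v \<in> V}" by blast
qed


section \<open>Involutions and strictly pseudoconformal manifolds\<close>

theorem corollary2p16:
  fixes A :: "('a::{t2_space, second_countable_topology}, real^4) chart set"
    and I J :: "'a \<Rightarrow> real^4 \<Rightarrow> real^4"
  assumes "psc_manifold A I J"
    and "\<exists>T. (\<forall>p. T (T p) = p) \<and> holomorphic_self_map A I T \<and> antiholomorphic_self_map A J T"
  shows "spsc_manifold A I J"
proof -
  from assms(1) obtain H where A: "smooth_atlas A" and H: "psc_subbundle A I J H"
    and I: "\<And>p. linear (I p)"
    unfolding psc_manifold_def complex_structure_def by blast
  from assms(2) obtain T where inv: "\<And>p. T (T p) = p"
    and hol: "holomorphic_self_map A I T" and anti: "antiholomorphic_self_map A J T"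
    by blast
  have T: "smooth_self_map A T" using hol unfolding holomorphic_self_map_def by blast
  have Hbun: "complex_subbundle A 1 H" and HI: "\<And>p. H p \<subseteq> T10 I p" and HJ: "\<And>p. H p \<subseteq> T10 J p"
    using H unfolding psc_subbundle_def common_subbundle_def id_push_eq[OF A] by auto
  define V where "V = involution_push A T H"
  have Vbun: "complex_subbundle A 1 V"
    unfolding V_def by (rule complex_subbundle_push[OF A T inv Hbun])
  have VI: "V p \<subseteq> T10 I p" for p
    unfolding V_def by (rule push_T10[where S = T and E = H and q = p, OF hol A inv HI])
  have VJ: "V p \<subseteq> T01 J p" for p
    unfolding V_def by (rule push_T01[where S = T and E = H and q = p, OF anti A inv HJ])
  have lines: "vec.subspace (H p)" "vec.dim (H p) = 1" "vec.subspace (V p)" "vec.dim (V p) = 1" for p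
    using Hbun Vbun unfolding complex_subbundle_def by auto
  have HV: "H p \<inter> V p = {0}" for p
    using HJ[of p] VJ[of p] T10_Int_T01[of J p] lines[of p] vec.subspace_0 by blast
  have "T10 I p = {h + v | h v. h \<in> H p \<and> v \<in> V p}" for p
    by (rule T10_eq_sum_of_lines[OF I lines(1,2) HI lines(3,4) VI HV])
  then show ?thesis
    unfolding spsc_manifold_def id_push_eq[OF A]
    using assms(1) H Vbun VI VJ HV by blast
qed

end
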